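(* Let $n\ge 1$ and let $\pi$ be any permutation of $\{1,2,3\}$. Among the $2^{n-1}$ compositions of $n$ into positive parts, the number of compositions that avoid $\pi$ does not depend on the choice of $\pi$.
   Context: A composition of $n$ into positive parts is a sequence $(x_1,\dots,x_k)$ of positive integers (for some $k\ge1$) with $x_1+\dots+x_k=n$; compositions differing only in the order of parts are distinct. A sequence $(x_1,\dots,x_k)$ contains the pattern $\pi=(\pi_1\pi_2\pi_3)\in S_3$ if there exist indices $i_1<i_2<i_3$ such that for all $a,b\in\{1,2,3\}$, $x_{i_a}<x_{i_b}$ whenever $\pi_a<\pi_b$ (strict inequalities; e.g. it contains $(132)$ if $x_{i_1}<x_{i_3}<x_{i_2}$). It avoids $\pi$ if it does not contain $\pi$. *)

theory Defs
  imports Main "HOL-Combinatorics.Permutations"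
begin

definition compositions :: "nat \<Rightarrow> nat list set" where
  "compositions n = {xs. xs \<noteq> [] \<and> (\<forall>x\<in>set xs. 0 < x) \<and> sum_list xs = n}"

(* Lists are indexed from 0, while the pattern and the chosen positions
   i 1 < i 2 < i 3 are indexed by 1, 2, 3. Here p is a permutation of {1, 2, 3}
   in one-line notation, p 1, p 2, p 3. *)
definition contains_pattern :: "nat list \<Rightarrow> (nat \<Rightarrow> nat) \<Rightarrow> bool" where
  "contains_pattern xs p \<longleftrightarrow>
     (\<exists>i::nat \<Rightarrow> nat. i 1 < i 2 \<and> i 2 < i 3 \<and> i 3 < length xs \<and>
        (\<forall>a\<in>{1, 2, 3}. \<forall>b\<in>{1, 2, 3}. p a < p b \<longrightarrow> xs ! i a < xs ! i b))"

definition avoids_pattern :: "nat list \<Rightarrow> (nat \<Rightarrow> nat) \<Rightarrow> bool" where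
  "avoids_pattern xs p \<longleftrightarrow> \<not> contains_pattern xs p"

end

theory Submission
  imports Defs "HOL-Library.Multiset" "HOL-Library.Sublist"
begin

text \<open>
  Fix the multiset of parts and build an arrangement from left to right. A part that is at most the
  current minimum \<open>m\<close> can be appended freely and becomes the new minimum; a part above \<open>m\<close> is forced:
  to avoid 123 it must be the largest remaining part, to avoid 132 the smallest remaining part
  above \<open>m\<close>. So in both cases the number of completions depends only on the remaining parts that are
  at most \<open>m\<close> and on how many remain above \<open>m\<close>, and it satisfies the same recursion. Hence 123 and
  132 are equally frequently avoided; reversing the order of the parts' values gives the same for
  321 and 312, and reversing the sequences links 123 with 321, 132 with 231 and 312 with 213.
\<close>

section \<open>Patterns as conditions on subsequences of length three\<close>

definition avoids3 :: "('a \<Rightarrow> 'a \<Rightarrow> 'a \<Rightarrow> bool) \<Rightarrow> 'a list \<Rightarrow> bool" where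
  "avoids3 P xs \<longleftrightarrow> (\<forall>a b c. subseq [a, b, c] xs \<longrightarrow> \<not> P a b c)"

text \<open>\<open>m\<close> stands for the least part already placed: for a greedy pattern it is
  all that has to be remembered of the prefix.\<close>

definition avoiders :: "('a \<Rightarrow> 'a \<Rightarrow> 'a \<Rightarrow> bool) \<Rightarrow> 'a \<Rightarrow> 'a multiset \<Rightarrow> 'a list set" where
  "avoiders P m M = {w. mset w = M \<and> avoids3 P (m # w)}"

lemma subseq_pair_in_set:
  assumes "subseq [b, c] w"
  shows "b \<in> set w" "c \<in> set w"
  using assms by (metis list.set_intros set_nths_subset subseq_conv_nths subsetD)+

lemma subseq_pair_Cons:
  "subseq [b, c] (x # w) \<longleftrightarrow> b = x \<and> c \<in> set w \<or> subseq [b, c] w"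
  by (auto simp: subseq_Cons2_iff subseq_singleton_left dest: subseq_pair_in_set)

lemma avoids3_Cons:
  "avoids3 P (x # w) \<longleftrightarrow> avoids3 P w \<and> (\<forall>b c. subseq [b, c] w \<longrightarrow> \<not> P x b c)"
proof -
  have *: "subseq [a, b, c] (x # w) \<longleftrightarrow> a = x \<and> subseq [b, c] w \<or> subseq [a, b, c] w" for a b c
    by (auto simp: subseq_Cons2_iff dest: subseq_Cons')
  show ?thesis
    unfolding avoids3_def * by blast
qed

text \<open>The triples starting with \<open>m\<close> are split by whether \<open>x\<close> is
  their second entry. For \<open>m < x\<close>, the condition on \<open>m\<close>, \<open>x\<close>,
  \<open>c\<close> is the one that will force \<open>x\<close>.\<close>

lemma avoids3_Cons2:
  "avoids3 P (m # x # w) \<longleftrightarrow> avoids3 P (x # w) \<and> (\<forall>c\<in>set w. \<not> P m x c) \<and>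
     (\<forall>b c. subseq [b, c] w \<longrightarrow> \<not> P m b c)"
  unfolding avoids3_Cons[of P m] subseq_pair_Cons by blast

lemma subseq_revI: "subseq xs ys \<Longrightarrow> subseq (rev xs) (rev ys)"
  by (induction rule: list_emb.induct) (auto intro: list_emb_append_mono)

lemma avoids3_rev: "avoids3 P (rev xs) \<longleftrightarrow> avoids3 (\<lambda>a b c. P c b a) xs"
proof -
  have "subseq [a, b, c] (rev xs) \<longleftrightarrow> subseq [c, b, a] xs" for a b c
    using subseq_revI[of "[a, b, c]" "rev xs"] subseq_revI[of "[c, b, a]" xs] by auto
  then show ?thesis
    unfolding avoids3_def by blast
qed

lemma finite_avoiders: "finite (avoiders P m M)"
proof (rule finite_subset)
  show "avoiders P m M \<subseteq> {w. set w \<subseteq> set_mset M \<and> length w = size M}"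
    by (auto simp: avoiders_def)
qed (simp add: finite_lists_length_eq)

section \<open>The common recursion for greedy patterns\<close>

context linorder
begin

text \<open>
  The choice \<open>s m M\<close> is the part above the current minimum \<open>m\<close> that pattern \<open>P\<close> forces.
\<close>

definition greedy :: "('a \<Rightarrow> 'a \<Rightarrow> 'a \<Rightarrow> bool) \<Rightarrow> ('a \<Rightarrow> 'a multiset \<Rightarrow> 'a) \<Rightarrow> bool" where
  "greedy P s \<longleftrightarrow>
     (\<forall>m x w. x \<le> m \<longrightarrow> avoids3 P (m # x # w) = avoids3 P (x # w)) \<and>
     (\<forall>m M. (\<exists>y\<in>#M. m < y) \<longrightarrow> s m M \<in># M \<and> m < s m M) \<and>
     (\<forall>m x w. m < x \<longrightarrow>
        avoids3 P (m # x # w) = (x = s m (mset (x # w)) \<and> avoids3 P (m # w)))"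

lemma greedy_choice:
  assumes "greedy P s" "\<exists>y\<in>#M. m < y"
  shows "s m M \<in># M" "m < s m M"
  using assms(1)[unfolded greedy_def, THEN conjunct2, THEN conjunct1, rule_format, OF assms(2)]
  by simp_all

text \<open>The arrangements are split by their first part \<open>x\<close>: if
  \<open>x \<le> m\<close>, it replaces \<open>m\<close>; otherwise it is the forced part and
  \<open>m\<close> stays. The value 1 counts the empty arrangement; the value 0 means that no part
  above \<open>m\<close> is left.\<close>

lemma card_avoiders_rec:
  assumes "greedy P s"
  shows "card (avoiders P m M) =
    (\<Sum>x\<in>set_mset (filter_mset (\<lambda>x. x \<le> m) M). card (avoiders P x (M - {#x#}))) +
    (if M = {#} then 1 else if \<exists>y\<in>#M. m < y then card (avoiders P m (M - {#s m M#})) else 0)"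
proof (cases "M = {#}")
  case True
  then have "avoiders P m M = {[]}"
    by (auto simp: avoiders_def avoids3_def dest: list_emb_length)
  with True show ?thesis by simp
next
  case False
  let ?I = "set_mset (filter_mset (\<lambda>x. x \<le> m) M)"
  let ?A = "\<Union>x\<in>?I. (#) x ` avoiders P x (M - {#x#})"
  let ?B = "if \<exists>y\<in>#M. m < y then (#) (s m M) ` avoiders P m (M - {#s m M#}) else {}"
  have le: "\<And>x w. x \<le> m \<Longrightarrow> avoids3 P (m # x # w) = avoids3 P (x # w)"
    and s: "\<exists>y\<in>#M. m < y \<Longrightarrow> s m M \<in># M \<and> m < s m M"
    and gt: "\<And>x w. m < x \<Longrightarrow>
        avoids3 P (m # x # w) = (x = s m (mset (x # w)) \<and> avoids3 P (m # w))"
    using assms unfolding greedy_def by blast+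
  have "w \<in> avoiders P m M \<longleftrightarrow> w \<in> ?A \<union> ?B" for w
  proof (cases w)
    case Nil
    then show ?thesis using False by (auto simp: avoiders_def)
  next
    case (Cons x v)
    have eq: "mset (x # v) = M \<longleftrightarrow> x \<in># M \<and> mset v = M - {#x#}"
      by (auto simp: insert_DiffM)
    show ?thesis
    proof (cases "x \<le> m")
      case True
      then have "x \<noteq> s m M" if "\<exists>y\<in>#M. m < y" using s[OF that] by auto
      with True Cons eq le[OF True] show ?thesis
        by (auto simp: avoiders_def)
    next
      case False
      then have "m < x" by simp
      then have "w \<in> avoiders P m M \<longleftrightarrow> x \<in># M \<and> mset v = M - {#x#} \<and> x = s m M \<and> avoids3 P (m # v)"
        unfolding avoiders_def using Cons eq gt[OF \<open>m < x\<close>, of v] by auto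
      with \<open>m < x\<close> Cons s show ?thesis
        by (auto simp: avoiders_def)
    qed
  qed
  then have split: "avoiders P m M = ?A \<union> ?B" by blast
  \<comment> \<open>The forced part exceeds \<open>m\<close>, so members of \<open>?A\<close> and
    \<open>?B\<close> differ in their first part.\<close>
  have "s m M \<notin> ?I" if "\<exists>y\<in>#M. m < y"
    using s[OF that] by (simp add: not_le)
  then have "?A \<inter> ?B = {}"
    by auto
  moreover have "finite ?A" "finite ?B" by (auto simp: finite_avoiders)
  ultimately have "card (avoiders P m M) = card ?A + card ?B"
    unfolding split by (rule card_Un_disjoint[rotated 2])
  moreover have "card ?A = (\<Sum>x\<in>?I. card ((#) x ` avoiders P x (M - {#x#})))"
    by (rule card_UN_disjoint) (auto simp: finite_avoiders)
  moreover have "card ((#) x ` X) = card X" for x and X :: "'a list set"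
    by (rule card_image) (auto simp: inj_on_def)
  ultimately show ?thesis using False by simp
qed

text \<open>Two multisets are compared because the two patterns may force different parts, after
  which the remaining multisets differ. Agreement of the sizes and of the parts up to
  \<open>m\<close> survives every step, and the recursion depends on nothing else.\<close>

lemma greedy_card_eq:
  assumes P: "greedy P s" and Q: "greedy Q t"
    and "filter_mset (\<lambda>x. x \<le> m) M = filter_mset (\<lambda>x. x \<le> m) N" "size M = size N"
  shows "card (avoiders P m M) = card (avoiders Q m N)"
  using assms(3,4)
proof (induction "size M" arbitrary: m M N rule: less_induct)
  case less
  let ?F = "\<lambda>m. filter_mset (\<lambda>x. x \<le> m)"
  have small: "card (avoiders P x (M - {#x#})) = card (avoiders Q x (N - {#x#}))"
    if "x \<in># ?F m M" for x
  proof (rule less.hyps)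
    have "x \<in># ?F m N"
      using that less.prems(1) by simp
    with that have x: "x \<in># M" "x \<in># N" "x \<le> m"
      by simp_all
    then show "size (M - {#x#}) < size M"
      by (simp add: size_Diff1_less)
    show "size (M - {#x#}) = size (N - {#x#})"
      using x less.prems(2) by (simp add: size_Diff_singleton)
    \<comment> \<open>As \<open>x \<le> m\<close>, agreement of the parts up to \<open>m\<close>
      gives agreement up to the new minimum \<open>x\<close>.\<close>
    have F: "?F x K = ?F x (?F m K)" for K
      using x(3) by (auto simp: filter_filter_mset intro!: filter_mset_cong)
    have "?F x M = ?F x N"
      by (subst (1 2) F) (simp only: less.prems(1))
    then show "?F x (M - {#x#}) = ?F x (N - {#x#})"
      by (simp add: filter_diff_mset)
  qed
  \<comment> \<open>Whether some part exceeds \<open>m\<close> can be read off from the size and the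
    parts up to \<open>m\<close>.\<close>
  have above: "(\<exists>y\<in>#K. m < y) \<longleftrightarrow> size (?F m K) \<noteq> size K" for K
  proof -
    have "size K = size (?F m K) + size {#y \<in># K. \<not> y \<le> m#}"
      by (metis multiset_partition size_union)
    then show ?thesis
      by (auto simp: not_le)
  qed
  have ex: "(\<exists>y\<in>#M. m < y) \<longleftrightarrow> (\<exists>y\<in>#N. m < y)"
    unfolding above less.prems ..
  have big: "card (avoiders P m (M - {#s m M#})) = card (avoiders Q m (N - {#t m N#}))"
    if "\<exists>y\<in>#N. m < y"
  proof (rule less.hyps)
    have "\<exists>y\<in>#M. m < y"
      using that unfolding ex .
    then have s: "s m M \<in># M" "\<not> s m M \<le> m" "t m N \<in># N" "\<not> t m N \<le> m"
      using greedy_choice[OF P] greedy_choice[OF Q that] by (simp_all add: not_le)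
    show "size (M - {#s m M#}) < size M"
      using s by (simp add: size_Diff1_less)
    show "size (M - {#s m M#}) = size (N - {#t m N#})"
      using s less.prems(2) by (simp add: size_Diff_singleton)
    \<comment> \<open>Both removed parts lie above \<open>m\<close>, so the parts up to
      \<open>m\<close> are untouched.\<close>
    show "?F m (M - {#s m M#}) = ?F m (N - {#t m N#})"
      using s less.prems(1) by (simp add: filter_diff_mset)
  qed
  have "M = {#} \<longleftrightarrow> N = {#}"
    using less.prems(2) by (metis size_eq_0_iff_empty)
  then show ?case
    unfolding card_avoiders_rec[OF P, of m M] card_avoiders_rec[OF Q, of m N]
    by (intro arg_cong2[of _ _ _ _ "(+)"] sum.cong if_cong refl small big ex)
      (simp_all only: less.prems(1))
qed

lemma greedy_123: "greedy (\<lambda>a b c. a < b \<and> b < c) (\<lambda>m M. Max (set_mset M))"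
  unfolding greedy_def
proof (intro conjI allI impI)
  fix m and M :: "'a multiset" assume "\<exists>y\<in>#M. m < y"
  then obtain y where y: "y \<in># M" "m < y" by blast
  then show "Max (set_mset M) \<in># M" by (intro Max_in) auto
  have "y \<le> Max (set_mset M)" using y by simp
  with y(2) show "m < Max (set_mset M)" by (rule less_le_trans)
next
  fix m x w assume "x \<le> m"
  \<comment> \<open>A 123 starting with \<open>m\<close> cannot continue with \<open>x\<close>, and
    it remains a 123 when \<open>x\<close> takes the place of \<open>m\<close>.\<close>
  then show "avoids3 (\<lambda>a b c. a < b \<and> b < c) (m # x # w) = avoids3 (\<lambda>a b c. a < b \<and> b < c) (x # w)"
    by (auto simp: avoids3_Cons subseq_pair_Cons simp del: subseq_Cons2_iff)
next
  fix m x w assume "m < x"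
  \<comment> \<open>A larger entry after \<open>x\<close> would complete a 123 with \<open>m\<close>
    and \<open>x\<close>, so \<open>x\<close> must be the maximum of what remains.\<close>
  have Max: "x = Max (set_mset (mset (x # w))) \<longleftrightarrow> (\<forall>c\<in>set w. \<not> (m < x \<and> x < c))"
    using \<open>m < x\<close> by (auto simp: eq_Max_iff not_less)
  \<comment> \<open>As no entry of \<open>w\<close> exceeds \<open>x\<close>, no 123 starts with
    \<open>x\<close>, and \<open>x\<close> can be forgotten.\<close>
  have "\<not> (x < b \<and> b < c)"
    if "\<forall>c\<in>set w. \<not> (m < x \<and> x < c)" "subseq [b, c] w" for b c
    using that(1) \<open>m < x\<close> subseq_pair_in_set(1)[OF that(2)] by blast
  then show "avoids3 (\<lambda>a b c. a < b \<and> b < c) (m # x # w) =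
      (x = Max (set_mset (mset (x # w))) \<and> avoids3 (\<lambda>a b c. a < b \<and> b < c) (m # w))"
    unfolding Max avoids3_Cons2 unfolding avoids3_Cons by blast
qed

lemma greedy_132:
  "greedy (\<lambda>a b c. a < c \<and> c < b) (\<lambda>m M. Min {y \<in> set_mset M. m < y})"
  unfolding greedy_def
proof (intro conjI allI impI)
  fix m and M :: "'a multiset" assume "\<exists>y\<in>#M. m < y"
  then have "Min {y \<in> set_mset M. m < y} \<in> {y \<in> set_mset M. m < y}"
    by (intro Min_in) auto
  then show "Min {y \<in> set_mset M. m < y} \<in># M" "m < Min {y \<in> set_mset M. m < y}" by auto
next
  fix m x w assume "x \<le> m"
  then show "avoids3 (\<lambda>a b c. a < c \<and> c < b) (m # x # w) = avoids3 (\<lambda>a b c. a < c \<and> c < b) (x # w)"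
    by (auto simp: avoids3_Cons subseq_pair_Cons simp del: subseq_Cons2_iff)
next
  fix m x w assume "m < x"
  \<comment> \<open>An entry of \<open>w\<close> strictly between \<open>m\<close> and
    \<open>x\<close> would complete a 132 with \<open>m\<close> and \<open>x\<close>.\<close>
  have Min: "x = Min {y \<in> set_mset (mset (x # w)). m < y} \<longleftrightarrow> (\<forall>c\<in>set w. \<not> (m < c \<and> c < x))"
    using \<open>m < x\<close> by (subst eq_Min_iff) (auto simp: not_less)
  \<comment> \<open>In any 132 that starts with \<open>x\<close>, the smaller \<open>m\<close> could
    replace \<open>x\<close>.\<close>
  have "\<not> (x < c \<and> c < b)"
    if "\<forall>b c. subseq [b, c] w \<longrightarrow> \<not> (m < c \<and> c < b)" "subseq [b, c] w" for b c
    using that \<open>m < x\<close> less_trans by blast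
  then show "avoids3 (\<lambda>a b c. a < c \<and> c < b) (m # x # w) =
      (x = Min {y \<in> set_mset (mset (x # w)). m < y} \<and> avoids3 (\<lambda>a b c. a < c \<and> c < b) (m # w))"
    unfolding Min avoids3_Cons2 unfolding avoids3_Cons by blast
qed

text \<open>Both patterns begin with their least entry, so a virtual first entry at least as large
  as every part starts neither of them. Prepending it brings all arrangements of \<open>M\<close>
  under the recursion.\<close>

lemma card_avoids_123_132:
  "card {w. mset w = M \<and> avoids3 (\<lambda>a b c. a < b \<and> b < c) w} =
   card {w. mset w = M \<and> avoids3 (\<lambda>a b c. a < c \<and> c < b) w}"
proof (cases "M = {#}")
  case True
  then have "{w. mset w = M \<and> avoids3 P w} = {[]}" for P
    by (auto simp: avoids3_def)
  then show ?thesis by simp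
next
  case False
  define m where "m = Max (set_mset M)"
  have "\<forall>y\<in>#M. y \<le> m" by (simp add: m_def)
  then have "\<not> m < b" if "mset w = M" "subseq [b, c] w" for w b c
    using subseq_pair_in_set(1)[OF that(2)] that(1) by (auto simp: not_less)
  then have eq: "avoiders P m M = {w. mset w = M \<and> avoids3 P w}"
    if "\<And>a b c. P a b c \<Longrightarrow> a < b" for P
    unfolding avoiders_def avoids3_Cons using that by blast
  have "avoiders (\<lambda>a b c. a < b \<and> b < c) m M =
      {w. mset w = M \<and> avoids3 (\<lambda>a b c. a < b \<and> b < c) w}"
    by (rule eq) simp
  moreover have "avoiders (\<lambda>a b c. a < c \<and> c < b) m M =
      {w. mset w = M \<and> avoids3 (\<lambda>a b c. a < c \<and> c < b) w}"
    by (rule eq) (blast intro: less_trans)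
  ultimately show ?thesis
    using greedy_card_eq[OF greedy_123 greedy_132 refl refl, of m M] by simp
qed

end

text \<open>The order is reversed, not the parts: complementing the values would change the
  multiset, while the result for a fixed multiset holds in every linear order.\<close>

lemmas card_avoids_321_312 = linorder.card_avoids_123_132[OF dual_linorder]

section \<open>Counting compositions\<close>

lemma finite_compositions: "finite (compositions n)"
proof (rule finite_subset)
  have "length xs \<le> sum_list xs" if "\<forall>x\<in>set xs. 0 < x" for xs :: "nat list"
    using that by (induction xs) auto
  then show "compositions n \<subseteq> {xs. set xs \<subseteq> {..n} \<and> length xs \<le> n}"
    by (auto simp: compositions_def member_le_sum_list)
qed (rule finite_lists_length_le, simp)

lemma card_compositions_Suc: "card (compositions (Suc n)) = 2 ^ n"
proof (induction n)
  case 0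
  have "sum_list xs = Suc 0 \<and> xs \<noteq> [] \<and> (\<forall>x\<in>set xs. 0 < x) \<longleftrightarrow> xs = [1]" for xs :: "nat list"
    by (cases xs; cases "tl xs") auto
  then have "compositions (Suc 0) = {[1]}"
    by (auto simp: compositions_def)
  then show ?case by simp
next
  case (Suc n)
  \<comment> \<open>A composition of the next number either gains a new first part 1 or has its
    first part increased by 1.\<close>
  let ?f = "(#) (1::nat)" and ?g = "\<lambda>xs. Suc (hd xs) # tl xs"
  have "xs \<in> compositions (Suc (Suc n)) \<longleftrightarrow>
      xs \<in> ?f ` compositions (Suc n) \<union> ?g ` compositions (Suc n)" for xs
  proof
    assume xs: "xs \<in> compositions (Suc (Suc n))"
    then obtain x ys where [simp]: "xs = x # ys" by (cases xs) (auto simp: compositions_def)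
    show "xs \<in> ?f ` compositions (Suc n) \<union> ?g ` compositions (Suc n)"
    proof (cases "x = 1")
      case True
      then show ?thesis using xs by (auto simp: compositions_def)
    next
      case False
      then have "(x - 1) # ys \<in> compositions (Suc n)" "xs = ?g ((x - 1) # ys)"
        using xs by (auto simp: compositions_def)
      then show ?thesis by blast
    qed
  next
    assume "xs \<in> ?f ` compositions (Suc n) \<union> ?g ` compositions (Suc n)"
    then show "xs \<in> compositions (Suc (Suc n))"
    proof (elim UnE imageE)
      fix ys assume "xs = ?g ys" "ys \<in> compositions (Suc n)"
      then show ?thesis by (cases ys) (auto simp: compositions_def)
    qed (auto simp: compositions_def)
  qed
  then have "compositions (Suc (Suc n)) = ?f ` compositions (Suc n) \<union> ?g ` compositions (Suc n)"
    by blast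
  \<comment> \<open>An increased first part is at least 2.\<close>
  moreover have "?f ` compositions (Suc n) \<inter> ?g ` compositions (Suc n) = {}"
    by (auto simp: compositions_def) (metis hd_in_set less_irrefl)
  moreover have "inj_on ?f (compositions (Suc n))" "inj_on ?g (compositions (Suc n))"
    by (auto simp: inj_on_def compositions_def intro: list.expand)
  ultimately show ?case
    using Suc.IH by (simp add: card_Un_disjoint finite_compositions card_image)
qed

section \<open>From multisets of parts to compositions, and reversal\<close>

definition num_avoiding :: "nat \<Rightarrow> (nat \<Rightarrow> nat \<Rightarrow> nat \<Rightarrow> bool) \<Rightarrow> nat" where
  "num_avoiding n P = card {xs \<in> compositions n. avoids3 P xs}"

text \<open>Compositions are grouped by their multiset of parts. Rearranging keeps the sum and
  positivity, so each group consists of all arrangements of its multiset.\<close>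

lemma num_avoiding_eqI:
  assumes "\<And>M. card {xs. mset xs = M \<and> avoids3 P xs} = card {xs. mset xs = M \<and> avoids3 Q xs}"
  shows "num_avoiding n P = num_avoiding n Q"
proof -
  have "num_avoiding n R = (\<Sum>M\<in>mset ` compositions n. card {xs. mset xs = M \<and> avoids3 R xs})" for R
  proof -
    have "num_avoiding n R = (\<Sum>xs\<in>compositions n. if avoids3 R xs then 1 else 0)"
      by (simp add: num_avoiding_def sum.If_cases finite_compositions Int_def)
    also have "\<dots> = (\<Sum>M\<in>mset ` compositions n.
        \<Sum>xs | xs \<in> compositions n \<and> mset xs = M. if avoids3 R xs then 1 else 0)"
      by (rule sum.image_gen) (rule finite_compositions)
    also have "\<dots> = (\<Sum>M\<in>mset ` compositions n. card {xs. mset xs = M \<and> avoids3 R xs})"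
    proof (rule sum.cong)
      fix M assume "M \<in> mset ` compositions n"
      then have "xs \<in> compositions n" if "mset xs = M" for xs
        using that by (auto simp: compositions_def dest: mset_eq_setD simp flip: sum_mset_sum_list)
      then have "{xs \<in> compositions n. mset xs = M} \<inter> {xs. avoids3 R xs} =
          {xs. mset xs = M \<and> avoids3 R xs}" by auto
      then show "(\<Sum>xs | xs \<in> compositions n \<and> mset xs = M. if avoids3 R xs then 1 else 0) =
          card {xs. mset xs = M \<and> avoids3 R xs}"
        by (simp add: sum.If_cases finite_compositions)
    qed simp
    finally show ?thesis .
  qed
  with assms show ?thesis by simp
qed

lemma num_avoiding_rev: "num_avoiding n (\<lambda>a b c. P c b a) = num_avoiding n P"
  unfolding num_avoiding_def
proof (rule bij_betw_same_card, rule bij_betwI[where f = rev and g = rev])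
qed (auto simp: compositions_def avoids3_rev)

lemma num_avoiding_eq:
  "num_avoiding n (\<lambda>a b c. a < c \<and> c < b) = num_avoiding n (\<lambda>a b c. a < b \<and> b < c)"
  "num_avoiding n (\<lambda>a b c. b < a \<and> a < c) = num_avoiding n (\<lambda>a b c. a < b \<and> b < c)"
  "num_avoiding n (\<lambda>a b c. c < a \<and> a < b) = num_avoiding n (\<lambda>a b c. a < b \<and> b < c)"
  "num_avoiding n (\<lambda>a b c. b < c \<and> c < a) = num_avoiding n (\<lambda>a b c. a < b \<and> b < c)"
  "num_avoiding n (\<lambda>a b c. c < b \<and> b < a) = num_avoiding n (\<lambda>a b c. a < b \<and> b < c)"
proof -
  have 1: "num_avoiding n (\<lambda>a b c. a < b \<and> b < c) = num_avoiding n (\<lambda>a b c. a < c \<and> c < b)"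
    by (rule num_avoiding_eqI) (rule card_avoids_123_132)
  have "num_avoiding n (\<lambda>a b c. b < a \<and> c < b) = num_avoiding n (\<lambda>a b c. c < a \<and> b < c)"
    by (rule num_avoiding_eqI) (rule card_avoids_321_312)
  then have 2: "num_avoiding n (\<lambda>a b c. c < b \<and> b < a) = num_avoiding n (\<lambda>a b c. b < c \<and> c < a)"
    by (simp add: conj_commute)
  show "num_avoiding n (\<lambda>a b c. a < c \<and> c < b) = num_avoiding n (\<lambda>a b c. a < b \<and> b < c)"
    "num_avoiding n (\<lambda>a b c. b < a \<and> a < c) = num_avoiding n (\<lambda>a b c. a < b \<and> b < c)"
    "num_avoiding n (\<lambda>a b c. c < a \<and> a < b) = num_avoiding n (\<lambda>a b c. a < b \<and> b < c)"
    "num_avoiding n (\<lambda>a b c. b < c \<and> c < a) = num_avoiding n (\<lambda>a b c. a < b \<and> b < c)"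
    "num_avoiding n (\<lambda>a b c. c < b \<and> b < a) = num_avoiding n (\<lambda>a b c. a < b \<and> b < c)"
    \<comment> \<open>The equalities link the six patterns in the chain 231, 132, 123, 321, 312,
      213, in which reversal alternates with \<open>1\<close> and \<open>2\<close>.\<close>
    using 1 2 num_avoiding_rev[of n "\<lambda>a b c. a < b \<and> b < c"]
      num_avoiding_rev[of n "\<lambda>a b c. a < c \<and> c < b"]
      num_avoiding_rev[of n "\<lambda>a b c. b < c \<and> c < a"] by simp_all
qed

section \<open>Translating indexed patterns into triples\<close>

text \<open>The offset \<open>n\<close> makes the step chainable: each chosen position supplies the
  offset of the next.\<close>

lemma subseq_nth_Cons_drop:
  assumes "n \<le> i" "i < length xs" "subseq ys (drop (Suc i) xs)"
  shows "subseq (xs ! i # ys) (drop n xs)"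
proof -
  have "subseq (xs ! i # ys) (drop i xs)"
    using assms(2,3) by (simp flip: Cons_nth_drop_Suc)
  moreover have "drop i xs = drop (i - n) (drop n xs)"
    using assms(1) by simp
  ultimately show ?thesis
    by (metis append_take_drop_id list_emb_append2)
qed

lemma subseq_conv_nth:
  "subseq [a, b, c] xs \<longleftrightarrow>
     (\<exists>i j k. i < j \<and> j < k \<and> k < length xs \<and> xs ! i = a \<and> xs ! j = b \<and> xs ! k = c)"
    (is "_ \<longleftrightarrow> ?R")
proof
  assume "subseq [a, b, c] xs"
  then obtain p q where 1: "xs = p @ a # q" "subseq [b, c] q"
    using list_emb_ConsD[of "(=)" a "[b, c]" xs] by auto
  then obtain r s where 2: "q = r @ b # s" "c \<in> set s"
    using list_emb_ConsD[of "(=)" b "[c]" q] by (auto simp: subseq_singleton_left)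
  then obtain t u where 3: "s = t @ c # u"
    by (auto dest: split_list)
  show ?R
    \<comment> \<open>The positions are the lengths of the prefixes before \<open>a\<close>,
      \<open>b\<close> and \<open>c\<close>.\<close>
    unfolding 1 2 3
    by (intro exI[of _ "length p"] exI[of _ "length (p @ a # r)"]
        exI[of _ "length (p @ a # r @ b # t)"]) (auto simp: nth_append)
next
  assume ?R
  then obtain i j k where "i < j" "j < k" "k < length xs" "a = xs ! i" "b = xs ! j" "c = xs ! k"
    by blast
  then show "subseq [a, b, c] xs"
    using subseq_nth_Cons_drop[of 0 i xs "[b, c]"] subseq_nth_Cons_drop[of "Suc i" j xs "[c]"]
      subseq_nth_Cons_drop[of "Suc j" k xs "[]"] by simp
qed

text \<open>Each ordered pair of distinct positions contributes one implication; for equal positions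
  the premise is false.\<close>

lemma avoids_pattern_conv:
  "avoids_pattern xs p \<longleftrightarrow> avoids3 (\<lambda>a b c.
     (p 1 < p 2 \<longrightarrow> a < b) \<and> (p 2 < p 1 \<longrightarrow> b < a) \<and> (p 1 < p 3 \<longrightarrow> a < c) \<and>
     (p 3 < p 1 \<longrightarrow> c < a) \<and> (p 2 < p 3 \<longrightarrow> b < c) \<and> (p 3 < p 2 \<longrightarrow> c < b)) xs"
  (is "_ \<longleftrightarrow> avoids3 ?R xs")
proof -
  have "contains_pattern xs p \<longleftrightarrow>
      (\<exists>i j k. i < j \<and> j < k \<and> k < length xs \<and> ?R (xs ! i) (xs ! j) (xs ! k))"
  proof
    assume "contains_pattern xs p"
    then obtain i where "i 1 < i 2" "i 2 < i 3" "i 3 < length xs"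
      "\<forall>a\<in>{1, 2, 3}. \<forall>b\<in>{1, 2, 3}. p a < p b \<longrightarrow> xs ! i a < xs ! i b"
      unfolding contains_pattern_def by blast
    then show "\<exists>i j k. i < j \<and> j < k \<and> k < length xs \<and> ?R (xs ! i) (xs ! j) (xs ! k)"
      by (intro exI[of _ "i 1"] exI[of _ "i 2"] exI[of _ "i 3"]) simp
  next
    assume "\<exists>i j k. i < j \<and> j < k \<and> k < length xs \<and> ?R (xs ! i) (xs ! j) (xs ! k)"
    then obtain i j k where "i < j \<and> j < k \<and> k < length xs \<and> ?R (xs ! i) (xs ! j) (xs ! k)"
      by blast
    then show "contains_pattern xs p"
      unfolding contains_pattern_def
      \<comment> \<open>The three positions are packed into one function; the default 0 is never
        read.\<close>
      by (intro exI[of _ "(\<lambda>_. 0)(1 := i, 2 := j, 3 := k)"]) simp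
  qed
  then show ?thesis
    unfolding avoids_pattern_def avoids3_def subseq_conv_nth by blast
qed

lemma card_avoids_pattern:
  assumes "p permutes {1, 2, 3}"
  shows "card {xs \<in> compositions n. avoids_pattern xs p} =
    num_avoiding n (\<lambda>a b c. a < b \<and> b < c)"
proof -
  \<comment> \<open>For each of the six permutations the implications collapse to a chain of two
    inequalities, the third following by transitivity.\<close>
  have *: ?thesis
    if "num_avoiding n P = num_avoiding n (\<lambda>a b c. a < b \<and> b < c)"
      and "\<And>a b c. P a b c \<longleftrightarrow>
        (p 1 < p 2 \<longrightarrow> a < b) \<and> (p 2 < p 1 \<longrightarrow> b < a) \<and> (p 1 < p 3 \<longrightarrow> a < c) \<and>
        (p 3 < p 1 \<longrightarrow> c < a) \<and> (p 2 < p 3 \<longrightarrow> b < c) \<and> (p 3 < p 2 \<longrightarrow> c < b)" for P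
    using that(1) unfolding avoids_pattern_conv that(2)[symmetric] num_avoiding_def .
  have "p 1 \<in> {1, 2, 3}" "p 2 \<in> {1, 2, 3}" "p 3 \<in> {1, 2, 3}"
    using permutes_in_image[OF assms, of 1] permutes_in_image[OF assms, of 2]
      permutes_in_image[OF assms, of 3] by simp_all
  moreover have "p 1 \<noteq> p 2" "p 1 \<noteq> p 3" "p 2 \<noteq> p 3"
    using permutes_inj[OF assms] by (simp_all add: inj_eq)
  ultimately consider "p 1 = 1" "p 2 = 2" "p 3 = 3" | "p 1 = 1" "p 2 = 3" "p 3 = 2"
    | "p 1 = 2" "p 2 = 1" "p 3 = 3" | "p 1 = 2" "p 2 = 3" "p 3 = 1"
    | "p 1 = 3" "p 2 = 1" "p 3 = 2" | "p 1 = 3" "p 2 = 2" "p 3 = 1"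
    by auto
  then show ?thesis
  proof cases
    case 1 then show ?thesis by (intro *[OF refl]) auto
  next
    case 2 then show ?thesis by (intro *[OF num_avoiding_eq(1)]) auto
  next
    case 3 then show ?thesis by (intro *[OF num_avoiding_eq(2)]) auto
  next
    case 4 then show ?thesis by (intro *[OF num_avoiding_eq(3)]) auto
  next
    case 5 then show ?thesis by (intro *[OF num_avoiding_eq(4)]) auto
  next
    case 6 then show ?thesis by (intro *[OF num_avoiding_eq(5)]) auto
  qed
qed

theorem theorem1:
  fixes n :: nat and \<pi> \<sigma> :: "nat \<Rightarrow> nat"
  assumes "1 \<le> n"
    and "\<pi> permutes {1, 2, 3}"
    and "\<sigma> permutes {1, 2, 3}"
  shows "card (compositions n) = 2 ^ (n - 1) \<and>
         card {xs \<in> compositions n. avoids_pattern xs \<pi>} =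
         card {xs \<in> compositions n. avoids_pattern xs \<sigma>}"
proof
  show "card (compositions n) = 2 ^ (n - 1)"
    using assms(1) card_compositions_Suc[of "n - 1"] by simp
  show "card {xs \<in> compositions n. avoids_pattern xs \<pi>} =
      card {xs \<in> compositions n. avoids_pattern xs \<sigma>}"
    using assms(2,3) by (simp only: card_avoids_pattern)
qed

end
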